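(* For every integer $k \geq 2$ and all sufficiently large $t$, \[ \hat{R}^{k}(BK_t, BK_t) > (1+o(1))\frac{\sqrt{2}}{e}\, t\, 2^{t/2},\] where $o(1)$ denotes a quantity tending to $0$ as $t\to\infty$.
   Context: A $k$-uniform hypergraph $\mathcal{H}=(V,E)$ has all edges of cardinality exactly $k$. It is covering if every pair of distinct vertices is contained in some edge. For a graph $G$, $\mathcal{H}$ contains a blue (resp. red) Berge-$G$ if there is an injection $\varphi:V(G)\to V(\mathcal{H})$ and an injection $f:E(G)\to E(\mathcal{H})$ with $\varphi(e)\subseteq f(e)$ and $f(e)$ blue (resp. red) for every $e\in E(G)$. The cover Ramsey number $\hat{R}^{k}(BG_1,BG_2)$ is the smallest integer $n_0$ such that for every covering $k$-uniform hypergraph $\mathcal{H}$ on $n\geq n_0$ vertices and every blue/red coloring of the edges of $\mathcal{H}$, there is either a blue Berge-$G_1$ or a red Berge-$G_2$ in $\mathcal{H}$. $K_t$ is the complete graph on $t$ vertices. *)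

theory Defs
  imports Complex_Main "HOL-Library.Ramsey"
begin

text \<open>A finite simple graph is given by its vertex set and its set of edges (2-element sets).\<close>

type_synonym 'a ugraph = "'a set \<times> 'a set set"

definition complete_graph :: "nat \<Rightarrow> nat ugraph" where
  "complete_graph t = ({..<t}, nsets {..<t} 2)"

definition uniform_hypergraph :: "nat \<Rightarrow> 'v set \<Rightarrow> 'v set set \<Rightarrow> bool" where
  "uniform_hypergraph k V E \<longleftrightarrow> finite V \<and> E \<subseteq> nsets V k"

definition covering :: "'v set \<Rightarrow> 'v set set \<Rightarrow> bool" where
  "covering V E \<longleftrightarrow> (\<forall>u\<in>V. \<forall>v\<in>V. u \<noteq> v \<longrightarrow> (\<exists>e\<in>E. u \<in> e \<and> v \<in> e))"

datatype colour = Blue | Red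

definition contains_berge ::
  "'v set \<Rightarrow> 'v set set \<Rightarrow> ('v set \<Rightarrow> colour) \<Rightarrow> colour \<Rightarrow> 'a ugraph \<Rightarrow> bool" where
  "contains_berge V E c b G \<longleftrightarrow>
     (\<exists>\<phi> f. inj_on \<phi> (fst G) \<and> \<phi> ` fst G \<subseteq> V \<and>
            inj_on f (snd G) \<and> f ` snd G \<subseteq> E \<and>
            (\<forall>e\<in>snd G. \<phi> ` e \<subseteq> f e \<and> c (f e) = b))"

text \<open>Hypergraphs are finite, so taking their vertices to be natural numbers loses no generality.
  For finite graphs the set of admissible \<open>n0\<close> is nonempty by Ramsey's theorem, so the
  least element below is meaningful.\<close>

definition cover_ramsey_bound :: "nat \<Rightarrow> 'a ugraph \<Rightarrow> 'b ugraph \<Rightarrow> nat \<Rightarrow> bool" where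
  "cover_ramsey_bound k G1 G2 n0 \<longleftrightarrow>
     (\<forall>(V :: nat set) E c. uniform_hypergraph k V E \<and> covering V E \<and> card V \<ge> n0 \<longrightarrow>
        contains_berge V E c Blue G1 \<or> contains_berge V E c Red G2)"

definition cover_ramsey :: "nat \<Rightarrow> 'a ugraph \<Rightarrow> 'b ugraph \<Rightarrow> nat" where
  "cover_ramsey k G1 G2 = (LEAST n0. cover_ramsey_bound k G1 G2 n0)"

end

theory Submission
  imports Defs "HOL-Real_Asymp.Real_Asymp"
begin

text \<open>If a 2-colouring of the pairs of an \<open>n\<close>-set has the property that every pair lies in a
  monochromatic \<open>k\<close>-set, then the monochromatic \<open>k\<close>-sets, coloured accordingly, form a covering
  \<open>k\<close>-uniform hypergraph, and each of its monochromatic Berge cliques is a monochromatic clique of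
  the pair colouring. So it suffices to add this property to Spencer's lower bound for the diagonal
  Ramsey number. Spencer's local lemma argument has room for it: whether a pair lies in a
  monochromatic \<open>k\<close>-set can be tested on \<open>O(t\<^sup>2)\<close> disjoint candidates, which fails with
  probability at most \<open>2\<^bsup>1-C(t,2)\<^esup>\<close>, the probability that a \<open>t\<close>-set is monochromatic, and the
  polynomial factor in the dependency degree disappears in the \<open>(t-2)\<close>-nd root.

  The cover Ramsey number is defined as a least element, so its finiteness is also needed.\<close>

section \<open>Finiteness of the cover Ramsey number\<close>

text \<open>Ramsey's theorem for partitions of an initial segment of the naturals, carried along a
  bijection to exactly \<open>ES r q1 q2\<close> points of \<open>V\<close>. The sizes
  \<open>q1\<close> and \<open>q2\<close> differ because the triple step below compares a fixed size
  with a large one.\<close>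

lemma ramsey_two_classes:
  "\<exists>N. \<forall>(V :: 'a set) P. finite V \<and> card V \<ge> N \<longrightarrow>
     (\<exists>H\<in>nsets V q1. \<forall>e\<in>nsets H r. P e) \<or> (\<exists>H\<in>nsets V q2. \<forall>e\<in>nsets H r. \<not> P e)"
proof (intro exI allI impI)
  let ?N = "ES r q1 q2"
  fix V :: "'a set" and P
  assume "finite V \<and> card V \<ge> ?N"
  then obtain W where W: "W \<subseteq> V" "card W = ?N" "finite W"
    by (meson obtain_subset_with_card_n)
  then obtain h where h: "bij_betw h {..<?N} W"
    using finite_same_card_bij[of "{..<?N}" W] by auto
  have inj: "inj_on h {..<?N}" and hV: "h ` {..<?N} \<subseteq> V"
    using h W by (auto simp: bij_betw_def)
  let ?f = "\<lambda>e. if P (h ` e) then 0 else (1::nat)"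
  have "?f \<in> nsets {..<?N} r \<rightarrow> {..<length [q1,q2]}"
    by auto
  then obtain i H where i: "i < 2" and H: "H \<in> nsets {..<?N} ([q1,q2] ! i)"
    and mono: "?f ` nsets H r \<subseteq> {i}"
    using ramsey2_full[of r q1 q2] unfolding partn_lst_def monochromatic_def
    by (metis One_nat_def Suc_1 length_Cons list.size(3))
  have HN: "H \<subseteq> {..<?N}" and fH: "finite H" and cH: "card H = [q1,q2] ! i"
    using H by (auto simp: nsets_def)
  have hH: "h ` H \<in> nsets V ([q1,q2] ! i)"
    using HN fH cH inj hV by (auto simp: nsets_def card_image inj_on_subset)
  have pre: "\<exists>e'\<in>nsets H r. e = h ` e'" if e: "e \<in> nsets (h ` H) r" for e
    using nset_image_obtains[OF e inj_on_subset[OF inj HN]] by metis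
  show "(\<exists>H\<in>nsets V q1. \<forall>e\<in>nsets H r. P e) \<or> (\<exists>H\<in>nsets V q2. \<forall>e\<in>nsets H r. \<not> P e)"
  proof (cases "i = 0")
    case True
    have "\<forall>e\<in>nsets (h ` H) r. P e"
    proof
      fix e assume "e \<in> nsets (h ` H) r"
      then obtain e' where "e' \<in> nsets H r" "e = h ` e'" using pre by blast
      then show "P e" using mono True by (auto simp: image_subset_iff split: if_splits)
    qed
    then show ?thesis using hH True by auto
  next
    case False
    then have "i = 1" using i by simp
    have "\<forall>e\<in>nsets (h ` H) r. \<not> P e"
    proof
      fix e assume "e \<in> nsets (h ` H) r"
      then obtain e' where "e' \<in> nsets H r" "e = h ` e'" using pre by blast
      then show "\<not> P e" using mono \<open>i = 1\<close> by (auto simp: image_subset_iff split: if_splits)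
    qed
    then show ?thesis using hH \<open>i = 1\<close> by auto
  qed
qed

text \<open>The ratio of triples to pairs in an \<open>m\<close>-set is \<open>(m - 2) / 3\<close>,
  which is \<open>k + 1/3\<close> for \<open>m = 3 * k + 3\<close>. Hence triples that consist of a
  pair and a point of a \<open>k\<close>-set attached to that pair cannot exhaust all
  triples.\<close>

lemma choose_3_gt: "(3 * k + 3 choose 2) * k < (3 * k + 3 choose 3)"
proof -
  let ?m = "3 * k + 3"
  have "3 * (?m choose 3) = (?m - 2) * (?m choose 2)"
    using binomial_absorption[of 2 "?m"] binomial_absorb_comp[of ?m 2]
    by (simp add: numeral_3_eq_3 numeral_2_eq_2)
  moreover have "(?m - 2) * (?m choose 2) = 3 * ((?m choose 2) * k) + (?m choose 2)"
    by (simp add: algebra_simps)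
  moreover have "(?m choose 2) > 0"
    by simp
  ultimately show ?thesis by linarith
qed

text \<open>Ramsey's theorem for triples yields a set in which the edge chosen for a pair contains no
  third point; there the choice of edges is injective, and Ramsey's theorem for pairs applies.\<close>

lemma cover_ramsey_bound_complete_graph_exists:
  "\<exists>n0. cover_ramsey_bound k (complete_graph t) (complete_graph t) n0"
proof -
  obtain N2 where N2: "\<forall>(V :: nat set) P. finite V \<and> card V \<ge> N2 \<longrightarrow>
     (\<exists>H\<in>nsets V t. \<forall>e\<in>nsets H 2. P e) \<or> (\<exists>H\<in>nsets V t. \<forall>e\<in>nsets H 2. \<not> P e)"
    using ramsey_two_classes[of t 2 t] by (rule exE)
  obtain N1 where N1: "\<forall>(V :: nat set) P. finite V \<and> card V \<ge> N1 \<longrightarrow>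
     (\<exists>H\<in>nsets V (3 * k + 3). \<forall>e\<in>nsets H 3. P e) \<or> (\<exists>H\<in>nsets V N2. \<forall>e\<in>nsets H 3. \<not> P e)"
    using ramsey_two_classes[of "3 * k + 3" 3 N2] by (rule exE)
  have "contains_berge V E c Blue (complete_graph t) \<or> contains_berge V E c Red (complete_graph t)"
    if V: "uniform_hypergraph k V E" "covering V E" "card V \<ge> N1" for V :: "nat set" and E c
  proof -
    have finV: "finite V" and E: "E \<subseteq> nsets V k"
      using V by (auto simp: uniform_hypergraph_def)
    have "\<exists>e\<in>E. p \<subseteq> e" if "p \<in> nsets V 2" for p
    proof -
      obtain u v where "p = {u, v}" "u \<in> V" "v \<in> V" "u \<noteq> v"
        using \<open>p \<in> nsets V 2\<close> by (rule nsets2_E)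
      then show ?thesis using V(2) unfolding covering_def by blast
    qed
    then obtain g where g: "\<And>p. p \<in> nsets V 2 \<Longrightarrow> g p \<in> E \<and> p \<subseteq> g p"
      by metis
    \<comment> \<open>A triple is bad if the edge chosen for one of its pairs swallows the third
      point.\<close>
    define bad where "bad = (\<lambda>s. \<exists>p\<in>nsets s 2. s \<subseteq> g p)"
    have "\<not> (\<exists>H\<in>nsets V (3 * k + 3). \<forall>e\<in>nsets H 3. bad e)"
    proof
      assume "\<exists>H\<in>nsets V (3 * k + 3). \<forall>e\<in>nsets H 3. bad e"
      then obtain H where H: "H \<subseteq> V" "finite H" "card H = 3 * k + 3"
        and bad: "\<And>e. e \<in> nsets H 3 \<Longrightarrow> bad e"
        by (auto simp: nsets_def)
      have gE: "finite (g p) \<and> card (g p) = k" if "p \<in> nsets H 2" for p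
        using g[of p] nsets_mono[OF H(1), of 2] that E by (auto simp: nsets_def)
      \<comment> \<open>A bad triple is a pair \<open>p\<close> plus a point of \<open>g p\<close>,
        so each pair accounts for at most \<open>k\<close> of them. This excludes the first Ramsey
        alternative for triples.\<close>
      have "nsets H 3 \<subseteq> (\<Union>p\<in>nsets H 2. (\<lambda>x. insert x p) ` g p)"
      proof
        fix s assume s: "s \<in> nsets H 3"
        then obtain p where p: "p \<in> nsets s 2" "s \<subseteq> g p"
          using bad unfolding bad_def by blast
        have "p \<subseteq> s" "card p = 2" "card s = 3" "finite s" "s \<subseteq> H"
          using p s by (auto simp: nsets_def)
        then have "card (s - p) = 1"
          by (simp add: card_Diff_subset finite_subset)
        then obtain x where x: "s - p = {x}"
          by (auto simp: card_1_singleton_iff)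
        then have "s = insert x p" "x \<in> g p"
          using \<open>p \<subseteq> s\<close> p(2) by auto
        moreover have "p \<in> nsets H 2"
          using p(1) \<open>s \<subseteq> H\<close> by (auto simp: nsets_def)
        ultimately show "s \<in> (\<Union>p\<in>nsets H 2. (\<lambda>x. insert x p) ` g p)"
          by blast
      qed
      then have "card (nsets H 3) \<le> card (\<Union>p\<in>nsets H 2. (\<lambda>x. insert x p) ` g p)"
        using gE H(2) by (intro card_mono finite_UN_I) (auto intro: finite_imp_finite_nsets)
      also have "\<dots> \<le> (\<Sum>p\<in>nsets H 2. card ((\<lambda>x. insert x p) ` g p))"
        using H(2) by (intro card_UN_le finite_imp_finite_nsets)
      also have "\<dots> \<le> (\<Sum>p\<in>nsets H 2. k)"
        using gE by (intro sum_mono) (metis card_image_le)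
      finally have "(3 * k + 3 choose 3) \<le> (3 * k + 3 choose 2) * k"
        using H by simp
      then show False using choose_3_gt[of k] by linarith
    qed
    then obtain S where S: "S \<subseteq> V" "finite S" "card S = N2"
      and good: "\<And>e. e \<in> nsets S 3 \<Longrightarrow> \<not> bad e"
      using N1[rule_format, OF conjI[OF finV V(3)], of bad] by (auto simp: nsets_def)
    have "\<exists>b. \<exists>H\<in>nsets S t. \<forall>e\<in>nsets H 2. c (g e) = b"
    proof -
      consider H where "H \<in> nsets S t" "\<forall>e\<in>nsets H 2. c (g e) = Blue"
        | H where "H \<in> nsets S t" "\<forall>e\<in>nsets H 2. c (g e) \<noteq> Blue"
        using N2[rule_format, of S "\<lambda>e. c (g e) = Blue"] S by auto
      then show ?thesis
        by cases (blast, metis colour.exhaust)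
    qed
    then obtain b H where H: "H \<in> nsets S t" and mono: "\<And>e. e \<in> nsets H 2 \<Longrightarrow> c (g e) = b"
      by blast
    obtain \<phi> where \<phi>: "bij_betw \<phi> {..<t} H"
      using H finite_same_card_bij[of "{..<t}" H] by (auto simp: nsets_def)
    have HS: "H \<subseteq> S" using H by (auto simp: nsets_def)
    have img: "\<phi> ` e \<in> nsets H 2" if "e \<in> nsets {..<t} 2" for e
      using that bij_betw_nsets[OF \<phi>, of 2] by (auto simp: bij_betw_def)
    \<comment> \<open>If two pairs shared their edge, one pair with a point of the other would be a
      bad triple inside \<open>S\<close>.\<close>
    have injg: "p = p'" if p: "p \<in> nsets S 2" "p' \<in> nsets S 2" "g p = g p'" for p p'
    proof (rule ccontr)
      assume "p \<noteq> p'"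
      have c: "finite p" "finite p'" "card p = 2" "card p' = 2" "p \<subseteq> S" "p' \<subseteq> S"
        using p by (auto simp: nsets_def)
      then obtain x where x: "x \<in> p'" "x \<notin> p"
        using \<open>p \<noteq> p'\<close> by (metis card_subset_eq subsetI)
      have "insert x p \<in> nsets S 3" "p \<in> nsets (insert x p) 2"
        using c x by (auto simp: nsets_def)
      moreover have "insert x p \<subseteq> g p"
        using g[of p] g[of p'] p x S(1) nsets_mono[of S V 2] by auto
      ultimately show False using good unfolding bad_def by blast
    qed
    have "contains_berge V E c b (complete_graph t)"
      unfolding contains_berge_def complete_graph_def fst_conv snd_conv
    proof (intro exI[of _ \<phi>] exI[of _ "\<lambda>e. g (\<phi> ` e)"] conjI ballI)
      show "inj_on \<phi> {..<t}" "\<phi> ` {..<t} \<subseteq> V"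
        using \<phi> HS S by (auto simp: bij_betw_def)
      show "inj_on (\<lambda>e. g (\<phi> ` e)) (nsets {..<t} 2)"
      proof (rule inj_onI)
        fix e e' assume e: "e \<in> nsets {..<t} 2" "e' \<in> nsets {..<t} 2" "g (\<phi> ` e) = g (\<phi> ` e')"
        then have "\<phi> ` e = \<phi> ` e'"
          using img injg nsets_mono[OF HS, of 2] by blast
        then show "e = e'"
          using e bij_betw_nsets[OF \<phi>, of 2] by (auto simp: bij_betw_def inj_on_def)
      qed
      have HV: "nsets H 2 \<subseteq> nsets V 2" using nsets_mono HS S(1) by (metis order_trans)
      show "(\<lambda>e. g (\<phi> ` e)) ` nsets {..<t} 2 \<subseteq> E"
        using img HV g by blast
      fix e assume "e \<in> nsets {..<t} 2"
      then show "\<phi> ` e \<subseteq> g (\<phi> ` e)" "c (g (\<phi> ` e)) = b"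
        using img HV g mono by blast+
    qed
    then show ?thesis by (cases b) auto
  qed
  then show ?thesis
    unfolding cover_ramsey_bound_def by blast
qed

section \<open>The local lemma for a uniformly random subset\<close>

text \<open>For finite \<open>E\<close> this is the normalised counting measure on
  \<open>Pow E\<close>. A random \<open>X\<close> stands for a random 2-colouring of
  \<open>E\<close>, with \<open>X\<close> as one colour class.\<close>

definition prob_subset :: "'e set \<Rightarrow> ('e set \<Rightarrow> bool) \<Rightarrow> real" where
  "prob_subset E A = real (card {X \<in> Pow E. A X}) / 2 ^ card E"

text \<open>This plays the part of measurability with respect to the coordinates in
  \<open>D\<close>; independence will come from disjointness of such sets.\<close>

definition depends_on :: "'e set \<Rightarrow> ('e set \<Rightarrow> bool) \<Rightarrow> bool" where
  "depends_on D A \<longleftrightarrow> (\<forall>X. A X = A (X \<inter> D))"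

lemma depends_on_mono:
  assumes "depends_on D A" "D \<subseteq> D'"
  shows "depends_on D' A"
  using assms unfolding depends_on_def by (metis Int_absorb1 Int_assoc)

lemma depends_on_all_not:
  assumes "\<And>j. j \<in> S \<Longrightarrow> depends_on (D j) (A j)"
  shows "depends_on (\<Union>j\<in>S. D j) (\<lambda>X. \<forall>j\<in>S. \<not> A j X)"
proof -
  have "depends_on (\<Union>j\<in>S. D j) (A j)" if "j \<in> S" for j
    using depends_on_mono[OF assms[OF that]] that by blast
  then show ?thesis unfolding depends_on_def by blast
qed

lemma prob_subset_nonneg: "prob_subset E A \<ge> 0"
  by (simp add: prob_subset_def)

lemma prob_subset_mono:
  assumes "finite E" "\<And>X. X \<subseteq> E \<Longrightarrow> A X \<Longrightarrow> B X"
  shows "prob_subset E A \<le> prob_subset E B"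
  unfolding prob_subset_def using assms
  by (intro divide_right_mono) (auto intro!: card_mono)

lemma prob_subset_disj_le:
  assumes "finite E"
  shows "prob_subset E (\<lambda>X. A X \<or> B X) \<le> prob_subset E A + prob_subset E B"
proof -
  have "{X \<in> Pow E. A X \<or> B X} = {X \<in> Pow E. A X} \<union> {X \<in> Pow E. B X}"
    by auto
  then have "card {X \<in> Pow E. A X \<or> B X} \<le> card {X \<in> Pow E. A X} + card {X \<in> Pow E. B X}"
    by (simp only: card_Un_le)
  then have "real (card {X \<in> Pow E. A X \<or> B X})
      \<le> real (card {X \<in> Pow E. A X}) + real (card {X \<in> Pow E. B X})"
    by linarith
  then show ?thesis
    unfolding prob_subset_def add_divide_distrib[symmetric] by (rule divide_right_mono) simp
qed

lemma prob_subset_Bex_le: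
  assumes "finite E" "finite S"
  shows "prob_subset E (\<lambda>X. \<exists>j\<in>S. A j X) \<le> (\<Sum>j\<in>S. prob_subset E (A j))"
  using assms(2)
proof (induction S rule: finite_induct)
  case empty
  then show ?case by (simp add: prob_subset_def)
next
  case (insert a S)
  then show ?case
    using prob_subset_disj_le[OF assms(1), of "A a" "\<lambda>X. \<exists>j\<in>S. A j X"] by simp
qed

lemma prob_subset_split:
  assumes "finite E"
  shows "prob_subset E A = prob_subset E (\<lambda>X. A X \<and> B X) + prob_subset E (\<lambda>X. A X \<and> \<not> B X)"
proof -
  have "card {X \<in> Pow E. A X} = card ({X \<in> Pow E. A X \<and> B X} \<union> {X \<in> Pow E. A X \<and> \<not> B X})"
    by (rule arg_cong[where f = card]) auto
  also have "\<dots> = card {X \<in> Pow E. A X \<and> B X} + card {X \<in> Pow E. A X \<and> \<not> B X}"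
    using assms by (intro card_Un_disjoint) auto
  finally show ?thesis
    by (simp add: prob_subset_def add_divide_distrib)
qed

lemma prob_subset_True: "finite E \<Longrightarrow> prob_subset E (\<lambda>X. True) = 1"
  by (simp add: prob_subset_def card_Pow flip: Pow_def)

text \<open>A subset of \<open>E\<close> is the same as its part inside \<open>D\<close> together
  with its part outside \<open>D\<close>, and each event sees only one of the two parts, so the
  counts multiply.\<close>

lemma prob_subset_indep:
  assumes fin: "finite E" and A: "depends_on D A" and B: "depends_on D' B" and D: "D \<inter> D' = {}"
  shows "prob_subset E (\<lambda>X. A X \<and> B X) = prob_subset E A * prob_subset E B"
proof -
  \<comment> \<open>Taking all of \<open>E - D\<close>, not only \<open>E \<inter> D'\<close>, makes
    \<open>F1\<close> and \<open>F2\<close> a partition of \<open>E\<close>.\<close>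
  define F1 F2 where "F1 = E \<inter> D" and "F2 = E - D"
  have card_conj: "card {X \<in> Pow E. P X \<and> Q X} = card {Y \<in> Pow F1. P Y} * card {Z \<in> Pow F2. Q Z}"
    if P: "depends_on D P" and Q: "depends_on D' Q" for P Q
  proof -
    have PY: "P (Y \<union> Z) = P Y" if "Y \<subseteq> F1" "Z \<subseteq> F2" for Y Z
    proof -
      have "(Y \<union> Z) \<inter> D = Y \<inter> D" using that by (auto simp: F2_def)
      then show ?thesis using P unfolding depends_on_def by metis
    qed
    have QZ: "Q (Y \<union> Z) = Q Z" if "Y \<subseteq> F1" "Z \<subseteq> F2" for Y Z
    proof -
      have "(Y \<union> Z) \<inter> D' = Z \<inter> D'" using that D by (auto simp: F1_def)
      then show ?thesis using Q unfolding depends_on_def by metis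
    qed
    have "bij_betw (\<lambda>(Y, Z). Y \<union> Z) ({Y \<in> Pow F1. P Y} \<times> {Z \<in> Pow F2. Q Z}) {X \<in> Pow E. P X \<and> Q X}"
    proof (rule bij_betw_byWitness[where f' = "\<lambda>X. (X \<inter> D, X - D)"])
      show "\<forall>a\<in>{Y \<in> Pow F1. P Y} \<times> {Z \<in> Pow F2. Q Z}.
          ((case a of (Y, Z) \<Rightarrow> Y \<union> Z) \<inter> D, (case a of (Y, Z) \<Rightarrow> Y \<union> Z) - D) = a"
        by (auto simp: F1_def F2_def)
      show "\<forall>a'\<in>{X \<in> Pow E. P X \<and> Q X}. (case (a' \<inter> D, a' - D) of (Y, Z) \<Rightarrow> Y \<union> Z) = a'"
        by auto
      show "(\<lambda>(Y, Z). Y \<union> Z) ` ({Y \<in> Pow F1. P Y} \<times> {Z \<in> Pow F2. Q Z}) \<subseteq> {X \<in> Pow E. P X \<and> Q X}"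
        using PY QZ by (auto simp: F1_def F2_def)
      show "(\<lambda>X. (X \<inter> D, X - D)) ` {X \<in> Pow E. P X \<and> Q X} \<subseteq> {Y \<in> Pow F1. P Y} \<times> {Z \<in> Pow F2. Q Z}"
      proof clarsimp
        fix X assume X: "X \<subseteq> E" "P X" "Q X"
        then have s: "X \<inter> D \<subseteq> F1" "X - D \<subseteq> F2" by (auto simp: F1_def F2_def)
        have "(X \<inter> D) \<union> (X - D) = X" by blast
        then show "X \<inter> D \<subseteq> F1 \<and> P (X \<inter> D) \<and> X - D \<subseteq> F2 \<and> Q (X - D)"
          using PY[OF s] QZ[OF s] X s by simp
      qed
    qed
    then show ?thesis
      by (simp add: bij_betw_same_card[symmetric] card_cartesian_product)
  qed
  have T: "depends_on D'' (\<lambda>_. True)" for D'' :: "'a set"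
    by (simp add: depends_on_def)
  have fF: "finite F1" "finite F2" "card E = card F1 + card F2"
    using fin card_Un_disjoint[of F1 F2] by (auto simp: F1_def F2_def Int_Diff_Un Int_Diff_disjoint)
  have pow: "card {Y \<in> Pow F. True} = 2 ^ card F" if "finite F" for F :: "'a set"
    using that by (simp add: card_Pow flip: Pow_def)
  \<comment> \<open>With \<open>a\<close> and \<open>b\<close> the counts of \<open>A\<close> on
    \<open>Pow F1\<close> and of \<open>B\<close> on \<open>Pow F2\<close>, the three instances
    count the conjunction as \<open>a * b\<close>, \<open>A\<close> alone as
    \<open>a * 2 ^ card F2\<close> and \<open>B\<close> alone as
    \<open>2 ^ card F1 * b\<close>.\<close>
  show ?thesis
    unfolding prob_subset_def
    using card_conj[OF A B] card_conj[OF A T] card_conj[OF T B] fF pow[of F1] pow[of F2]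
    by (simp add: power_add)
qed

text \<open>The usual induction, with \<open>2p\<close> as the bound on the conditional probabilities.\<close>

theorem symmetric_lovasz_local_lemma:
  fixes A :: "'i \<Rightarrow> 'e set \<Rightarrow> bool"
  assumes fin: "finite E" "finite I"
    and dep: "\<And>i. i \<in> I \<Longrightarrow> depends_on (D i) (A i)"
    and p: "\<And>i. i \<in> I \<Longrightarrow> prob_subset E (A i) \<le> p"
    and d: "\<And>i. i \<in> I \<Longrightarrow> real (card {j \<in> I. D j \<inter> D i \<noteq> {}}) \<le> d"
    and pd: "4 * p * d \<le> 1" and "d \<ge> 1"
  shows "\<exists>X\<subseteq>E. \<forall>i\<in>I. \<not> A i X"
proof (cases "I = {}")
  case True
  then show ?thesis by auto
next
  case False
  then have p0: "p \<ge> 0"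
    using p prob_subset_nonneg order_trans by blast
  have "p * 1 \<le> p * d"
    using p0 \<open>d \<ge> 1\<close> by (rule mult_left_mono[rotated])
  then have p2: "2 * p < 1"
    using pd by linarith
  define none where "none = (\<lambda>S X. \<forall>j\<in>S. \<not> A j X)"
  \<comment> \<open>The second part bounds the conditional probability of \<open>A i\<close> given
    \<open>none S\<close>, multiplied out to avoid division. Positivity for \<open>S\<close> follows
    from both parts for \<open>S\<close> with one index removed.\<close>
  have main: "prob_subset E (none S) > 0 \<and>
      (\<forall>i\<in>I. prob_subset E (\<lambda>X. none S X \<and> A i X) \<le> 2 * p * prob_subset E (none S))"
    if "S \<subseteq> I" for S
    using finite_subset[OF that fin(2)] that
  proof (induction S rule: finite_psubset_induct)
    case (psubset S)
    have pos: "prob_subset E (none S) > 0"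
    proof (cases "S = {}")
      case True
      then show ?thesis using prob_subset_True[OF fin(1)] by (simp add: none_def)
    next
      case False
      then obtain a where a: "a \<in> S" by blast
      let ?S = "S - {a}"
      have IH: "prob_subset E (none ?S) > 0"
          "prob_subset E (\<lambda>X. none ?S X \<and> A a X) \<le> 2 * p * prob_subset E (none ?S)"
        using psubset.IH[of ?S] a psubset.prems by auto
      have "none S = (\<lambda>X. none ?S X \<and> \<not> A a X)"
        using a by (auto simp: none_def)
      then have "prob_subset E (none S)
          = prob_subset E (none ?S) - prob_subset E (\<lambda>X. none ?S X \<and> A a X)"
        using prob_subset_split[OF fin(1), of "none ?S" "A a"] by simp
      also have "\<dots> \<ge> (1 - 2 * p) * prob_subset E (none ?S)"
        using IH(2) by (simp add: algebra_simps)
      finally show ?thesis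
        using IH(1) p2 by (smt (verit) mult_pos_pos)
    qed
    have "prob_subset E (\<lambda>X. none S X \<and> A i X) \<le> 2 * p * prob_subset E (none S)" if i: "i \<in> I" for i
    proof -
      \<comment> \<open>\<open>S1\<close> collects the neighbours of \<open>i\<close>; the events in
        \<open>S2\<close> are jointly independent of \<open>A i\<close>.\<close>
      define S1 S2 where "S1 = {j \<in> S. D j \<inter> D i \<noteq> {}}" and "S2 = {j \<in> S. D j \<inter> D i = {}}"
      have S12: "S = S1 \<union> S2" "S2 \<subseteq> S" "S1 \<subseteq> I" "finite S1"
        using psubset.prems psubset.hyps by (auto simp: S1_def S2_def)
      have dS2: "depends_on (\<Union>j\<in>S2. D j) (none S2)"
        unfolding none_def using dep psubset.prems S12 by (intro depends_on_all_not) auto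
      have "prob_subset E (\<lambda>X. none S X \<and> A i X) \<le> prob_subset E (\<lambda>X. none S2 X \<and> A i X)"
        using S12(2) by (intro prob_subset_mono fin) (auto simp: none_def)
      also have "\<dots> = prob_subset E (none S2) * prob_subset E (A i)"
        by (rule prob_subset_indep[OF fin(1) dS2 dep[OF i]]) (auto simp: S2_def)
      also have "\<dots> \<le> prob_subset E (none S2) * p"
        using p[OF i] by (intro mult_left_mono prob_subset_nonneg)
      \<comment> \<open>Avoiding the events of \<open>S1\<close> as well costs at most a factor 2:
        given \<open>none S2\<close>, their total probability is at most \<open>2 * p * d\<close>,
        hence at most 1/2. If \<open>S1\<close> is empty then \<open>S2 = S\<close>, which is not a
        smaller set, so that case is separate.\<close>
      also have "prob_subset E (none S2) \<le> 2 * prob_subset E (none S)"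
      proof (cases "S1 = {}")
        case True
        then show ?thesis using S12 pos by simp
      next
        case False
        then have "S2 \<subset> S" by (auto simp: S1_def S2_def)
        then have IH: "prob_subset E (\<lambda>X. none S2 X \<and> A j X) \<le> 2 * p * prob_subset E (none S2)"
          if "j \<in> I" for j
          using psubset.IH[of S2] psubset.prems that by auto
        have "real (card S1) \<le> real (card {j \<in> I. D j \<inter> D i \<noteq> {}})"
          using psubset.prems fin by (auto simp: S1_def intro!: card_mono)
        then have c: "real (card S1) \<le> d" using d[OF i] by linarith
        have "prob_subset E (none S2) = prob_subset E (\<lambda>X. none S2 X \<and> (\<exists>j\<in>S1. A j X))
            + prob_subset E (\<lambda>X. none S2 X \<and> \<not> (\<exists>j\<in>S1. A j X))"
          by (rule prob_subset_split[OF fin(1)])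
        also have "(\<lambda>X. none S2 X \<and> \<not> (\<exists>j\<in>S1. A j X)) = none S"
          using S12(1) by (auto simp: none_def)
        also have "(\<lambda>X. none S2 X \<and> (\<exists>j\<in>S1. A j X)) = (\<lambda>X. \<exists>j\<in>S1. none S2 X \<and> A j X)"
          by auto
        also have "prob_subset E \<dots> \<le> (\<Sum>j\<in>S1. prob_subset E (\<lambda>X. none S2 X \<and> A j X))"
          by (rule prob_subset_Bex_le[OF fin(1) S12(4)])
        also have "\<dots> \<le> (\<Sum>j\<in>S1. 2 * p * prob_subset E (none S2))"
          using IH S12(3) by (intro sum_mono) auto
        also have "\<dots> = real (card S1) * (2 * p * prob_subset E (none S2))"
          by simp
        also have "\<dots> \<le> d * (2 * p * prob_subset E (none S2))"
          using c p0 by (intro mult_right_mono) (auto simp: prob_subset_nonneg)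
        also have "\<dots> = (4 * p * d) * (prob_subset E (none S2) / 2)"
          by simp
        also have "\<dots> \<le> 1 * (prob_subset E (none S2) / 2)"
          using pd by (intro mult_right_mono) (auto simp: prob_subset_nonneg)
        finally show ?thesis by simp
      qed
      finally show ?thesis using p0 by (simp add: mult_right_mono mult_ac)
    qed
    then show ?case using pos by blast
  qed
  have "prob_subset E (none I) > 0"
    using main[of I] by simp
  then have "{X \<in> Pow E. none I X} \<noteq> {}"
    unfolding prob_subset_def by (metis card.empty div_0 less_irrefl of_nat_0)
  then show ?thesis by (auto simp: none_def)
qed

section \<open>Probabilities of elementary events, and families of disjoint sets\<close>

lemma depends_on_not: "depends_on D A \<Longrightarrow> depends_on D (\<lambda>X. \<not> A X)"
  by (simp add: depends_on_def)

lemma prob_subset_disjoint: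
  assumes "finite E" "F \<subseteq> E"
  shows "prob_subset E (\<lambda>X. F \<inter> X = {}) = 1 / 2 ^ card F"
proof -
  have "{X \<in> Pow E. F \<inter> X = {}} = Pow (E - F)" by auto
  moreover have "card E = card F + card (E - F)"
    using assms by (metis card_Diff_subset card_mono finite_subset le_add_diff_inverse)
  ultimately show ?thesis
    using assms by (simp add: prob_subset_def card_Pow power_add)
qed

lemma prob_subset_superset:
  assumes "finite E" "F \<subseteq> E"
  shows "prob_subset E (\<lambda>X. F \<subseteq> X) = 1 / 2 ^ card F"
proof -
  have "bij_betw (\<lambda>X. E - X) {X \<in> Pow E. F \<subseteq> X} {X \<in> Pow E. F \<inter> X = {}}"
    using assms(2) by (intro bij_betw_byWitness[where f' = "\<lambda>X. E - X"]) auto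
  then have "prob_subset E (\<lambda>X. F \<subseteq> X) = prob_subset E (\<lambda>X. F \<inter> X = {})"
    by (simp add: prob_subset_def bij_betw_same_card)
  then show ?thesis using prob_subset_disjoint[OF assms] by simp
qed

lemma prob_subset_none_indep:
  assumes fin: "finite E"
    and dep: "\<And>i. i < M \<Longrightarrow> depends_on (D i) (A i)"
    and disj: "\<And>i j. i < j \<Longrightarrow> j < M \<Longrightarrow> D i \<inter> D j = {}"
    and pr: "\<And>i. i < M \<Longrightarrow> prob_subset E (A i) = a"
  shows "prob_subset E (\<lambda>X. \<forall>i<M. \<not> A i X) = (1 - a) ^ M"
  using dep disj pr
proof (induction M)
  case 0
  then show ?case using prob_subset_True[OF fin] by simp
next
  case (Suc M)
  have IH: "prob_subset E (\<lambda>X. \<forall>i<M. \<not> A i X) = (1 - a) ^ M"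
    using Suc.prems by (intro Suc.IH) auto
  have "depends_on (\<Union>i\<in>{..<M}. D i) (\<lambda>X. \<forall>i\<in>{..<M}. \<not> A i X)"
    using Suc.prems by (intro depends_on_all_not) auto
  then have dM: "depends_on (\<Union>i<M. D i) (\<lambda>X. \<forall>i<M. \<not> A i X)"
    by (simp add: Ball_def)
  have "(\<Union>i<M. D i) \<inter> D M = {}"
    using Suc.prems(2)[of _ M] by auto
  then have "prob_subset E (\<lambda>X. (\<forall>i<M. \<not> A i X) \<and> \<not> A M X)
      = prob_subset E (\<lambda>X. \<forall>i<M. \<not> A i X) * prob_subset E (\<lambda>X. \<not> A M X)"
    using Suc.prems(1)[of M] by (intro prob_subset_indep[OF fin dM] depends_on_not) auto
  moreover have "prob_subset E (\<lambda>X. \<not> A M X) = 1 - a"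
    using prob_subset_split[OF fin, of "\<lambda>_. True" "A M"] prob_subset_True[OF fin] Suc.prems(3)[of M]
    by simp
  moreover have "(\<lambda>X. \<forall>i<Suc M. \<not> A i X) = (\<lambda>X. (\<forall>i<M. \<not> A i X) \<and> \<not> A M X)"
    by (auto simp: less_Suc_eq)
  ultimately show ?case using IH by simp
qed

lemma disjoint_subsets_exist:
  assumes "finite S" "M * m \<le> card S"
  shows "\<exists>W :: nat \<Rightarrow> 'a set. (\<forall>i<M. W i \<subseteq> S \<and> card (W i) = m) \<and>
           (\<forall>i<M. \<forall>j<M. i \<noteq> j \<longrightarrow> W i \<inter> W j = {})"
  using assms
proof (induction M arbitrary: S)
  case 0
  then show ?case by simp
next
  case (Suc M)
  then obtain U where U: "U \<subseteq> S" "card U = m" "finite U"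
    by (metis add_leD1 mult_Suc obtain_subset_with_card_n)
  have "M * m \<le> card (S - U)"
    using Suc.prems U by (simp add: card_Diff_subset)
  then obtain W where W: "\<forall>i<M. W i \<subseteq> S - U \<and> card (W i) = m"
      "\<forall>i<M. \<forall>j<M. i \<noteq> j \<longrightarrow> W i \<inter> W j = {}"
    using Suc.IH[of "S - U"] Suc.prems by auto
  show ?case
  proof (intro exI[of _ "W(M := U)"] conjI allI impI)
    fix i assume "i < Suc M"
    then show "(W(M := U)) i \<subseteq> S" "card ((W(M := U)) i) = m"
      using W U by (auto simp: less_Suc_eq)
    fix j assume "j < Suc M" "i \<noteq> j"
    with \<open>i < Suc M\<close> show "(W(M := U)) i \<inter> (W(M := U)) j = {}"
      using W by (simp add: less_Suc_eq) blast
  qed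
qed

section \<open>Pair colourings without large cliques in which every pair is well covered\<close>

text \<open>\<open>T\<close> is recovered from \<open>T - f\<close>. Counting these remainders in
  all of \<open>V\<close> is slightly wasteful but sufficient for the degree bound in the local
  lemma.\<close>

lemma card_nsets_containing_le:
  assumes "finite V" "f \<in> nsets V r"
  shows "card {T \<in> nsets V t. f \<subseteq> T} \<le> card V choose (t - r)"
proof -
  have "card {T \<in> nsets V t. f \<subseteq> T} \<le> card (nsets V (t - r))"
  proof (rule card_inj_on_le)
    show "inj_on (\<lambda>T. T - f) {T \<in> nsets V t. f \<subseteq> T}"
      by (auto simp: inj_on_def)
    show "(\<lambda>T. T - f) ` {T \<in> nsets V t. f \<subseteq> T} \<subseteq> nsets V (t - r)"
      using assms by (auto simp: nsets_def card_Diff_subset)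
    show "finite (nsets V (t - r))"
      using assms by (simp add: finite_imp_finite_nsets)
  qed
  then show ?thesis by simp
qed

lemma card_of_mem_nsets: "T \<in> nsets V t \<Longrightarrow> card T = t"
  by (simp add: nsets_def)

text \<open>\<open>X\<close> is one colour class of a 2-colouring of pairs; the other class is its
  complement.\<close>

definition mono_pairs :: "'a set set \<Rightarrow> 'a set \<Rightarrow> bool" where
  "mono_pairs X S \<longleftrightarrow> nsets S 2 \<subseteq> X \<or> nsets S 2 \<inter> X = {}"

lemma depends_on_mono_pairs: "depends_on (nsets S 2) (\<lambda>X. mono_pairs X S)"
  unfolding depends_on_def mono_pairs_def by blast

text \<open>The local lemma is applied to the events that a \<open>t\<close>-set is monochromatic and, for a pair
  \<open>e\<close>, that none of \<open>M\<close> sets \<open>e \<union> W\<^sub>i\<close> is, where the \<open>W\<^sub>i\<close> are disjoint of size \<open>k - 2\<close>.\<close>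

lemma colouring_exists:
  fixes V :: "'a set"
  assumes V: "finite V" "card V = n" and k: "k \<ge> 2"
    and room: "M * (k - 2) + 2 \<le> n"
    and s: "t choose 2 \<le> s" "M * (k choose 2) \<le> s"
    and M: "(1 - 1 / 2 ^ ((k choose 2) - 1)) ^ M \<le> (1 / 2 ^ (t choose 2) :: real)"
    and lll: "8 * (real s * real (n choose (t - 2)) + real (n choose 2)) \<le> 2 ^ (t choose 2)"
  shows "\<exists>X. (\<forall>T\<in>nsets V t. \<not> mono_pairs X T) \<and>
             (\<forall>e\<in>nsets V 2. \<exists>S\<in>nsets V k. e \<subseteq> S \<and> mono_pairs X S)"
proof -
  define E where "E = nsets V 2"
  have finE: "finite E" using V by (simp add: E_def finite_imp_finite_nsets)
  have "\<exists>W :: nat \<Rightarrow> 'a set. (\<forall>i<M. W i \<subseteq> V - e \<and> card (W i) = k - 2) \<and>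
           (\<forall>i<M. \<forall>j<M. i \<noteq> j \<longrightarrow> W i \<inter> W j = {})" if "e \<in> E" for e
    using that V room
    by (intro disjoint_subsets_exist) (auto simp: E_def nsets_def card_Diff_subset)
  then obtain W :: "'a set \<Rightarrow> nat \<Rightarrow> 'a set" where
    W: "\<And>e i. e \<in> E \<Longrightarrow> i < M \<Longrightarrow> W e i \<subseteq> V - e \<and> card (W e i) = k - 2"
    and Wdisj: "\<And>e i j. e \<in> E \<Longrightarrow> i < M \<Longrightarrow> j < M \<Longrightarrow> i \<noteq> j \<Longrightarrow> W e i \<inter> W e j = {}"
    by metis
  define U where "U = (\<lambda>e i. e \<union> W e i)"
  have U: "U e i \<in> nsets V k" if "e \<in> E" "i < M" for e i
  proof -
    have "card (e \<union> W e i) = card e + card (W e i)"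
      using W[OF that] that V by (intro card_Un_disjoint) (auto simp: E_def nsets_def intro: finite_subset)
    then show ?thesis
      using W[OF that] that V k by (auto simp: U_def E_def nsets_def intro: finite_subset)
  qed
  define A where "A = (\<lambda>z X. case z of Inl T \<Rightarrow> mono_pairs X T | Inr e \<Rightarrow> \<forall>i<M. \<not> mono_pairs X (U e i))"
  define D where "D = (\<lambda>z. case z of Inl T \<Rightarrow> nsets T 2 | Inr e \<Rightarrow> (\<Union>i<M. nsets (U e i) 2))"
  define I where "I = nsets V t <+> E"
  \<comment> \<open>The 2 counts the colours: that of a monochromatic \<open>t\<close>-set for the
    first kind of event, that of the pair \<open>e\<close> for the second.\<close>
  define p where "p = (2 / 2 ^ (t choose 2) :: real)"
  define d where "d = real s * real (n choose (t - 2)) + real (n choose 2)"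
  have DE: "D z \<subseteq> E" if "z \<in> I" for z
  proof -
    have "f \<in> E" if "T \<in> nsets V r" "f \<in> nsets T 2" for T r f
      using that by (auto simp: E_def nsets_def)
    then show ?thesis using that U by (fastforce simp: I_def D_def)
  qed
  have cD: "card (D z) \<le> s" if "z \<in> I" for z
  proof (cases z)
    case (Inl T)
    then show ?thesis using that s by (auto simp: I_def D_def card_of_mem_nsets)
  next
    case (Inr e)
    then have e: "e \<in> E" using that by (auto simp: I_def)
    have "card (D z) \<le> (\<Sum>i<M. card (nsets (U e i) 2))"
      unfolding D_def Inr sum.case by (rule card_UN_le) simp
    also have "\<dots> = (\<Sum>i<M. k choose 2)"
      using card_of_mem_nsets[OF U[OF e]] by (intro sum.cong) auto
    finally show ?thesis using s by simp
  qed
  have dep: "depends_on (D z) (A z)" if "z \<in> I" for z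
  proof (cases z)
    case (Inl T)
    then show ?thesis using depends_on_mono_pairs by (simp add: A_def D_def)
  next
    case (Inr e)
    have "depends_on (\<Union>i\<in>{..<M}. nsets (U e i) 2) (\<lambda>X. \<forall>i\<in>{..<M}. \<not> mono_pairs X (U e i))"
      by (intro depends_on_all_not depends_on_mono_pairs)
    then show ?thesis by (simp add: A_def D_def Inr Ball_def)
  qed
  have prob: "prob_subset E (A z) \<le> p" if "z \<in> I" for z
  proof (cases z)
    case (Inl T)
    then have T: "T \<in> nsets V t" using that by (auto simp: I_def)
    have TE: "nsets T 2 \<subseteq> E" using DE[OF that] by (simp add: D_def Inl)
    have c: "card (nsets T 2) = t choose 2" using card_of_mem_nsets[OF T] by simp
    have "prob_subset E (A z) \<le> prob_subset E (\<lambda>X. nsets T 2 \<subseteq> X) + prob_subset E (\<lambda>X. nsets T 2 \<inter> X = {})"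
      unfolding A_def Inl sum.case mono_pairs_def by (rule prob_subset_disj_le[OF finE])
    then show ?thesis
      using prob_subset_superset[OF finE TE] prob_subset_disjoint[OF finE TE] c by (simp add: p_def)
  next
    case (Inr e)
    then have e: "e \<in> E" using that by (auto simp: I_def)
    then have e2: "finite e" "card e = 2" by (auto simp: E_def nsets_def)
    \<comment> \<open>The sets \<open>U e i\<close> all contain the pair \<open>e\<close>, so their
      being monochromatic involves a common coordinate. Removing \<open>e\<close> leaves disjoint
      sets of pairs and hence independent events.\<close>
    define R where "R = (\<lambda>i. nsets (U e i) 2 - {e})"
    have ins: "nsets (U e i) 2 = insert e (R i)" for i
      using e2 by (auto simp: R_def U_def nsets_def)
    have RE: "R i \<subseteq> E" and cR: "card (R i) = (k choose 2) - 1" if "i < M" for i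
    proof -
      show "R i \<subseteq> E" using DE[of z] \<open>z \<in> I\<close> that by (auto simp: R_def D_def Inr)
      have "card (nsets (U e i) 2) = k choose 2"
        using card_of_mem_nsets[OF U[OF e that]] by simp
      moreover have "e \<in> nsets (U e i) 2"
        using ins by simp
      ultimately show "card (R i) = (k choose 2) - 1" by (simp add: R_def)
    qed
    have Rdisj: "R i \<inter> R j = {}" if "i < j" "j < M" for i j
    proof (rule ccontr)
      assume "R i \<inter> R j \<noteq> {}"
      then obtain f where f: "f \<subseteq> U e i" "f \<subseteq> U e j" "card f = 2" "f \<noteq> e"
        by (auto simp: R_def nsets_def)
      then have "f \<subseteq> e" using Wdisj[OF e, of i j] that by (auto simp: U_def)
      then show False using f e2 by (metis card_subset_eq)
    qed
    have sup: "prob_subset E (\<lambda>X. \<forall>i<M. \<not> R i \<subseteq> X) = (1 - 1 / 2 ^ ((k choose 2) - 1)) ^ M"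
    proof (rule prob_subset_none_indep[OF finE _ Rdisj])
      show "depends_on (R i) (\<lambda>X. R i \<subseteq> X)" for i
        by (auto simp: depends_on_def)
    qed (use prob_subset_superset[OF finE RE] cR in auto)
    have dis: "prob_subset E (\<lambda>X. \<forall>i<M. \<not> R i \<inter> X = {}) = (1 - 1 / 2 ^ ((k choose 2) - 1)) ^ M"
    proof (rule prob_subset_none_indep[OF finE _ Rdisj])
      show "depends_on (R i) (\<lambda>X. R i \<inter> X = {})" for i
        by (auto simp: depends_on_def)
    qed (use prob_subset_disjoint[OF finE RE] cR in auto)
    \<comment> \<open>Whichever colour \<open>e\<close> has, no \<open>R i\<close> is entirely of
      that colour. Forgetting the colour of \<open>e\<close> leaves a union of two events that
      depend on the sets \<open>R i\<close> only.\<close>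
    have "prob_subset E (A z) \<le> prob_subset E (\<lambda>X. (\<forall>i<M. \<not> R i \<subseteq> X) \<or> (\<forall>i<M. \<not> R i \<inter> X = {}))"
    proof (rule prob_subset_mono[OF finE])
      fix X assume "A z X"
      then have "\<forall>i<M. \<not> (insert e (R i) \<subseteq> X) \<and> insert e (R i) \<inter> X \<noteq> {}"
        by (simp add: A_def Inr mono_pairs_def ins)
      then show "(\<forall>i<M. \<not> R i \<subseteq> X) \<or> (\<forall>i<M. \<not> R i \<inter> X = {})"
        by (cases "e \<in> X") auto
    qed
    also have "\<dots> \<le> prob_subset E (\<lambda>X. \<forall>i<M. \<not> R i \<subseteq> X) + prob_subset E (\<lambda>X. \<forall>i<M. \<not> R i \<inter> X = {})"
      by (rule prob_subset_disj_le[OF finE])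
    also have "\<dots> \<le> p"
      unfolding sup dis p_def using M by simp
    finally show ?thesis .
  qed
  have degree: "real (card {j \<in> I. D j \<inter> D z \<noteq> {}}) \<le> d" if z: "z \<in> I" for z
  proof -
    let ?C = "\<lambda>f. {T \<in> nsets V t. f \<subseteq> T}"
    have finD: "finite (D z)" using DE[OF z] finE finite_subset by blast
    have finC: "finite (?C f)" for f
      using V by (simp add: finite_imp_finite_nsets)
    \<comment> \<open>A neighbouring \<open>t\<close>-set contains one of the pairs in
      \<open>D z\<close>. The pair events are all counted as neighbours, which adds only
      \<open>n choose 2\<close>.\<close>
    have "{j \<in> I. D j \<inter> D z \<noteq> {}} \<subseteq> (\<Union>f\<in>D z. ?C f) <+> E"
      by (auto simp: I_def D_def nsets_def)
    then have "card {j \<in> I. D j \<inter> D z \<noteq> {}} \<le> card ((\<Union>f\<in>D z. ?C f) <+> E)"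
      using finD finE finC by (intro card_mono finite_Plus) auto
    also have "\<dots> = card (\<Union>f\<in>D z. ?C f) + card E"
      using finD finE finC by (intro card_Plus) auto
    also have "card (\<Union>f\<in>D z. ?C f) \<le> (\<Sum>f\<in>D z. card (?C f))"
      by (rule card_UN_le[OF finD])
    also have "\<dots> \<le> (\<Sum>f\<in>D z. n choose (t - 2))"
      using card_nsets_containing_le[OF V(1), of _ 2 t] DE[OF z] V(2)
      by (intro sum_mono) (auto simp: E_def)
    also have "\<dots> \<le> s * (n choose (t - 2))"
      using cD[OF z] by simp
    finally have "card {j \<in> I. D j \<inter> D z \<noteq> {}} \<le> s * (n choose (t - 2)) + (n choose 2)"
      using V by (simp add: E_def)
    then have "real (card {j \<in> I. D j \<inter> D z \<noteq> {}}) \<le> real (s * (n choose (t - 2)) + (n choose 2))"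
      by (simp only: of_nat_le_iff)
    then show ?thesis by (simp add: d_def)
  qed
  have "\<exists>X\<subseteq>E. \<forall>z\<in>I. \<not> A z X"
  proof (rule symmetric_lovasz_local_lemma[OF finE _ dep prob degree])
    show "finite I" using V finE by (simp add: I_def finite_imp_finite_nsets)
    show "4 * p * d \<le> 1"
      using lll by (simp add: p_def d_def field_simps)
    have "n choose 2 \<ge> 1" using room by (simp add: Suc_le_eq)
    then have "real (n choose 2) \<ge> 1" by linarith
    moreover have "real s * real (n choose (t - 2)) \<ge> 0" by simp
    ultimately show "d \<ge> 1" unfolding d_def by linarith
  qed
  then obtain X where X: "\<And>z. z \<in> I \<Longrightarrow> \<not> A z X" by blast
  show ?thesis
  proof (intro exI[of _ X] conjI ballI)
    fix T assume "T \<in> nsets V t"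
    then show "\<not> mono_pairs X T" using X[of "Inl T"] by (auto simp: I_def A_def)
  next
    fix e assume "e \<in> nsets V 2"
    then have e: "e \<in> E" by (simp add: E_def)
    then obtain i where i: "i < M" "mono_pairs X (U e i)"
      using X[of "Inr e"] by (auto simp: I_def A_def)
    then show "\<exists>S\<in>nsets V k. e \<subseteq> S \<and> mono_pairs X S"
      using U[OF e] by (intro bexI[of _ "U e i"]) (auto simp: U_def)
  qed
qed

section \<open>From pair colourings to the cover Ramsey number\<close>

lemma cover_ramsey_bound_mono:
  "cover_ramsey_bound k G1 G2 m \<Longrightarrow> m \<le> n \<Longrightarrow> cover_ramsey_bound k G1 G2 n"
  unfolding cover_ramsey_bound_def by (meson order_trans)

text \<open>Take the monochromatic \<open>k\<close>-sets as hyperedges. Each pair of core vertices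
  of a Berge clique lies in a hyperedge whose pairs all have the colour of the clique, so the core
  would be a monochromatic \<open>t\<close>-set.\<close>

lemma cover_ramsey_complete_graph_gt:
  fixes V :: "nat set"
  assumes V: "finite V" "card V = n" and k: "k \<ge> 2"
    and no_mono: "\<And>T. T \<in> nsets V t \<Longrightarrow> \<not> mono_pairs X T"
    and cover: "\<And>e. e \<in> nsets V 2 \<Longrightarrow> \<exists>S\<in>nsets V k. e \<subseteq> S \<and> mono_pairs X S"
  shows "cover_ramsey k (complete_graph t) (complete_graph t) > n"
proof -
  define E where "E = {S \<in> nsets V k. mono_pairs X S}"
  define c where "c = (\<lambda>S. if nsets S 2 \<subseteq> X then Blue else Red)"
  have "\<not> contains_berge V E c b (complete_graph t)" for b
  proof
    assume "contains_berge V E c b (complete_graph t)"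
    then obtain \<phi> f where \<phi>: "inj_on \<phi> {..<t}" "\<phi> ` {..<t} \<subseteq> V"
      and fE: "f ` nsets {..<t} 2 \<subseteq> E" and fb: "\<forall>e\<in>nsets {..<t} 2. \<phi> ` e \<subseteq> f e \<and> c (f e) = b"
      unfolding contains_berge_def complete_graph_def fst_conv snd_conv by (elim exE conjE)
    have f: "f e \<in> E \<and> \<phi> ` e \<subseteq> f e \<and> c (f e) = b" if "e \<in> nsets {..<t} 2" for e
      using fE fb that by blast
    have T: "\<phi> ` {..<t} \<in> nsets V t"
      using \<phi> by (auto simp: nsets_def card_image)
    have col: "p \<in> X \<longleftrightarrow> b = Blue" if p: "p \<in> nsets (\<phi> ` {..<t}) 2" for p
    proof -
      obtain e where e: "e \<in> nsets {..<t} 2" "p = \<phi> ` e"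
        using p \<phi>(1) by (rule nset_image_obtains)
      then have "p \<in> nsets (f e) 2" "mono_pairs X (f e)" "c (f e) = b"
        using f[OF e(1)] p by (auto simp: nsets_def E_def)
      then show ?thesis
        unfolding mono_pairs_def c_def by (auto split: if_splits)
    qed
    have "mono_pairs X (\<phi> ` {..<t})"
      unfolding mono_pairs_def using col by (cases b) auto
    then show False using no_mono[OF T] by simp
  qed
  moreover have "uniform_hypergraph k V E"
    using V by (auto simp: uniform_hypergraph_def E_def)
  moreover have "covering V E"
    unfolding covering_def
  proof (intro ballI impI)
    fix u v assume "u \<in> V" "v \<in> V" "u \<noteq> v"
    then show "\<exists>e\<in>E. u \<in> e \<and> v \<in> e"
      using cover[of "{u, v}"] by (auto simp: E_def)
  qed
  ultimately have "\<not> cover_ramsey_bound k (complete_graph t) (complete_graph t) n"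
    unfolding cover_ramsey_bound_def using V by blast
  \<comment> \<open>Because some bound exists, the least element is itself a bound; by monotonicity
    it cannot be at most \<open>n\<close>.\<close>
  moreover have "cover_ramsey_bound k (complete_graph t) (complete_graph t)
      (cover_ramsey k (complete_graph t) (complete_graph t))"
    unfolding cover_ramsey_def using cover_ramsey_bound_complete_graph_exists by (rule LeastI_ex)
  ultimately show ?thesis
    using cover_ramsey_bound_mono by (metis not_less)
qed

section \<open>Asymptotics\<close>

text \<open>\<open>m ^ m / fact m\<close> is a single term of the exponential series at
  \<open>m\<close>.\<close>

lemma fact_ge_power_div_exp: "(real m / exp 1) ^ m \<le> fact m"
proof -
  have "(\<Sum>n\<in>{m}. real m ^ n /\<^sub>R fact n) \<le> (\<Sum>n. real m ^ n /\<^sub>R fact n)"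
    by (intro sum_le_suminf summable_exp_generic) auto
  then have "real m ^ m / fact m \<le> exp (real m)"
    by (simp add: exp_def divide_inverse mult.commute)
  moreover have "exp (real m) = exp 1 ^ m"
    by (simp flip: exp_of_nat_mult)
  ultimately show ?thesis
    by (simp add: power_divide field_simps)
qed

lemma binomial_le_pow_nat: "n choose r \<le> n ^ r"
proof -
  have "(n choose r) * 1 \<le> (n choose r) * fact r" by (intro mult_le_mono2 fact_ge_1)
  then show ?thesis using binomial_fact_pow[of n r] by linarith
qed

text \<open>Among \<open>2 ^ q\<close> independent trials with success probability
  \<open>1 / 2 ^ q\<close>, all fail with probability at most 1/e, hence at most 1/2. This dictates
  the number of candidate sets per pair.\<close>

lemma one_minus_power_le:
  "(1 - 1 / 2 ^ q) ^ (2 ^ q * m) \<le> (1 / 2 ^ m :: real)"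
proof -
  have "(1 - 1 / 2 ^ q) \<le> exp (- (1 / 2 ^ q) :: real)"
    using exp_ge_add_one_self[of "- (1 / 2 ^ q) :: real"] by simp
  then have "(1 - 1 / 2 ^ q) ^ (2 ^ q) \<le> exp (- (1 / 2 ^ q) :: real) ^ (2 ^ q)"
    by (intro power_mono) auto
  also have "\<dots> = exp (- 1)"
    by (simp flip: exp_of_nat_mult)
  also have "\<dots> \<le> (1 / 2 :: real)"
    using exp_ge_add_one_self[of "1 :: real"] by (simp add: exp_minus field_simps)
  finally have "((1 - 1 / 2 ^ q) ^ (2 ^ q)) ^ m \<le> (1 / 2 :: real) ^ m"
    by (intro power_mono) auto
  then show ?thesis by (simp add: power_mult power_one_over)
qed

text \<open>This is the solution \<open>n\<close> of the local lemma condition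
  \<open>8 t\<^sup>3 n\<^bsup>t-2\<^esup> = (t-2)! 2\<^bsup>C(t,2)\<^esup>\<close>, after replacing \<open>(t-2)!\<close> by \<open>((t-2)/e)\<^bsup>t-2\<^esup>\<close>
  and \<open>C(t,2) / (t-2) = (t+1)/2 + 1/(t-2)\<close> by \<open>(t+1)/2\<close>.\<close>

definition spencer_bound :: "nat \<Rightarrow> real" where
  "spencer_bound t =
     (real t - 2) / exp 1 * 2 powr ((real t + 1) / 2) * (8 * real t ^ 3) powr (- 1 / (real t - 2))"

text \<open>The factor \<open>sqrt 2\<close> is the extra half in the exponent
  \<open>(t + 1) / 2\<close>; a fixed polynomial in \<open>t\<close> raised to
  \<open>-1 / (t - 2)\<close> tends to 1.\<close>

lemma spencer_bound_asymp:
  "(\<lambda>t. spencer_bound t / (sqrt 2 / exp 1 * real t * 2 powr (real t / 2)) - 1) \<longlonglongrightarrow> 0"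
proof -
  have "(\<lambda>t. (1 - 2 / real t) * (8 * real t ^ 3) powr (- 1 / (real t - 2)) - 1) \<longlonglongrightarrow> 0"
    by real_asymp
  moreover have "\<forall>\<^sub>F t in sequentially. (1 - 2 / real t) * (8 * real t ^ 3) powr (- 1 / (real t - 2)) - 1
      = spencer_bound t / (sqrt 2 / exp 1 * real t * 2 powr (real t / 2)) - 1"
    using eventually_gt_at_top[of 0]
  proof eventually_elim
    case (elim t)
    have "2 powr ((real t + 1) / 2) = sqrt 2 * 2 powr (real t / 2)"
      by (simp add: add_divide_distrib powr_add powr_half_sqrt)
    then show ?case
      using elim by (simp add: spencer_bound_def field_simps)
  qed
  ultimately show ?thesis by (rule Lim_transform_eventually)
qed

text \<open>The growth is exponential. The summand 1 survives rounding down, so the integer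
  \<open>n\<close> used later is at least \<open>t ^ 6\<close>.\<close>

lemma spencer_bound_ge: "\<forall>\<^sub>F t in sequentially. spencer_bound t \<ge> real t ^ 6 + 1"
  unfolding spencer_bound_def by real_asymp

text \<open>The power \<open>t - 2\<close> undoes the root in \<open>spencer_bound\<close>, and both
  simplifications made in that formula err on the small side.\<close>

lemma spencer_bound_power:
  assumes "t \<ge> 3" "real n \<le> spencer_bound t"
  shows "8 * real t ^ 3 * real n ^ (t - 2) \<le> fact (t - 2) * 2 ^ (t choose 2)"
proof -
  let ?m = "t - 2"
  have m: "real ?m = real t - 2" "real ?m > 0" using assms by auto
  have pos: "8 * real t ^ 3 > 0" using assms by simp
  have "real n ^ ?m \<le> spencer_bound t ^ ?m"
    using assms by (intro power_mono) auto
  also have "\<dots> = (real ?m / exp 1) ^ ?m * (2 powr ((real t + 1) / 2)) ^ ?m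
      * ((8 * real t ^ 3) powr (- 1 / real ?m)) ^ ?m"
    unfolding spencer_bound_def m(1) power_mult_distrib ..
  also have "((8 * real t ^ 3) powr (- 1 / real ?m)) ^ ?m = 1 / (8 * real t ^ 3)"
  proof -
    have "((8 * real t ^ 3) powr (- 1 / real ?m)) ^ ?m = (8 * real t ^ 3) powr (real ?m * (- 1 / real ?m))"
      using pos by (intro powr_power) auto
    also have "real ?m * (- 1 / real ?m) = - 1" using m by simp
    finally show ?thesis using pos by (simp add: powr_minus_divide)
  qed
  also have "(real ?m / exp 1) ^ ?m * (2 powr ((real t + 1) / 2)) ^ ?m * (1 / (8 * real t ^ 3))
      \<le> fact ?m * 2 ^ (t choose 2) * (1 / (8 * real t ^ 3))"
  proof (intro mult_right_mono mult_mono)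
    have "(2 powr ((real t + 1) / 2)) ^ ?m = 2 powr ((real t + 1) / 2 * real ?m)"
      by (simp add: powr_power mult.commute)
    \<comment> \<open>The exponent on the left equals \<open>(t choose 2) - 1\<close>.\<close>
    also have "\<dots> \<le> 2 powr real (t choose 2)"
    proof (rule powr_mono)
      have "real (t choose 2) = real t * (real t - 1) / 2"
        using assms by (simp add: choose_two real_of_nat_div)
      then show "(real t + 1) / 2 * real ?m \<le> real (t choose 2)"
        unfolding m(1) by (simp add: field_simps)
    qed simp
    also have "\<dots> = 2 ^ (t choose 2)"
      by (simp add: powr_realpow)
    finally show "(2 powr ((real t + 1) / 2)) ^ ?m \<le> 2 ^ (t choose 2)" .
  qed (auto intro: fact_ge_power_div_exp)
  finally show ?thesis
    using pos by (simp add: pos_le_divide_eq mult.commute)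
qed

text \<open>The local lemma colouring is instantiated with \<open>s = t ^ 3 - 1\<close>. The 1 left
  over from \<open>t ^ 3\<close> pays for the term \<open>n choose 2\<close> in the degree.\<close>

lemma cover_ramsey_gt_spencer_bound:
  assumes k: "k \<ge> 2" and t: "t \<ge> 2 ^ ((k choose 2) - 1) * ((k choose 2) + k) + 5"
    and large: "spencer_bound t \<ge> real t ^ 6 + 1"
  shows "real (cover_ramsey k (complete_graph t) (complete_graph t)) > spencer_bound t"
proof -
  define n where "n = nat \<lfloor>spencer_bound t\<rfloor>"
  define q where "q = (k choose 2) - 1"
  \<comment> \<open>\<open>K\<close> does not depend on \<open>t\<close>, and
    \<open>M * (k choose 2) + M * k = K * (t choose 2)\<close>. So \<open>t \<ge> K + 5\<close>
    gives both the room for the disjoint sets and the bound \<open>s\<close> on the pairs they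
    involve.\<close>
  define K where "K = 2 ^ q * ((k choose 2) + k)"
  define M where "M = 2 ^ q * (t choose 2)"
  have t5: "t \<ge> K + 5" using t by (simp add: K_def q_def)
  have "spencer_bound t \<ge> 0" using large by (smt (verit) zero_le_power of_nat_0_le_iff)
  then have n: "real n \<le> spencer_bound t" "spencer_bound t < real n + 1"
    by (auto simp: n_def)
  then have "real (t ^ 6) \<le> real n" using large unfolding of_nat_power by linarith
  then have n6: "t ^ 6 \<le> n" by (simp only: of_nat_le_iff)
  have tt: "t choose 2 \<le> t ^ 2" by (rule binomial_le_pow_nat)
  have Kt: "K * t ^ 2 + t ^ 2 \<le> t ^ 3"
  proof -
    have "(K + 1) * t ^ 2 \<le> t * t ^ 2" using t5 by (intro mult_right_mono) auto
    then show ?thesis by (simp add: power3_eq_cube power2_eq_square)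
  qed
  have t2: "t ^ 2 \<ge> 25" using power_mono[of 5 t 2] t5 by simp
  have Mk: "M * (k choose 2) + M * k \<le> K * t ^ 2"
  proof -
    have "M * (k choose 2) + M * k = K * (t choose 2)" by (simp add: M_def K_def algebra_simps)
    then show ?thesis using tt by simp
  qed
  have "t ^ 3 * 1 \<le> t ^ 3 * t ^ 3" using t5 by (intro mult_left_mono) auto
  then have t36: "t ^ 3 \<le> t ^ 6" by (simp flip: power_add)
  have "M * (k - 2) \<le> M * k" by simp
  then have room: "M * (k - 2) + 2 \<le> n"
    using Mk Kt t2 t36 n6 by linarith
  have s1: "t choose 2 \<le> t ^ 3 - 1"
  proof -
    have "K \<ge> 1" using k by (simp add: K_def Suc_le_eq)
    then have "1 * t ^ 2 \<le> K * t ^ 2" by (intro mult_right_mono) auto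
    then show ?thesis using Kt tt t2 by linarith
  qed
  have s2: "M * (k choose 2) \<le> t ^ 3 - 1"
    using Mk Kt t2 by linarith
  have M: "(1 - 1 / 2 ^ ((k choose 2) - 1)) ^ M \<le> (1 / 2 ^ (t choose 2) :: real)"
    unfolding M_def q_def by (rule one_minus_power_le)
  have fin: "n choose 2 \<le> n ^ 2" by (rule binomial_le_pow_nat)
  \<comment> \<open>The aim is to absorb \<open>n choose 2\<close> into one copy of
    \<open>n ^ (t - 2)\<close>, for which \<open>fact (t - 2)\<close> must be at most
    \<open>n ^ (t - 4)\<close>. Since \<open>n \<ge> t ^ 6\<close>, it is enough that
    \<open>t - 2 \<le> 6 * (t - 4)\<close>, true from \<open>t = 5\<close> on.\<close>
  have "fact (t - 2) \<le> (t - 2) ^ (t - 2)"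
    using fact_le_power[of "t - 2", where 'a = nat] by simp
  also have "\<dots> \<le> t ^ (t - 2)" by (intro power_mono) auto
  also have "\<dots> \<le> t ^ (6 * (t - 4))" using t5 by (intro power_increasing) auto
  also have "\<dots> = (t ^ 6) ^ (t - 4)" by (simp add: power_mult)
  also have "\<dots> \<le> n ^ (t - 4)" using n6 by (intro power_mono) auto
  finally have "(n choose 2) * fact (t - 2) \<le> n ^ 2 * n ^ (t - 4)"
    using fin by (intro mult_mono) auto
  also have "\<dots> = n ^ (2 + (t - 4))" by (rule power_add[symmetric])
  also have "2 + (t - 4) = t - 2" using t5 by simp
  finally have c2: "(n choose 2) * fact (t - 2) \<le> n ^ (t - 2)" .
  have ct: "(n choose (t - 2)) * fact (t - 2) \<le> n ^ (t - 2)"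
    by (rule binomial_fact_pow)
  have "((t ^ 3 - 1) * (n choose (t - 2)) + (n choose 2)) * fact (t - 2)
      = (t ^ 3 - 1) * ((n choose (t - 2)) * fact (t - 2)) + (n choose 2) * fact (t - 2)"
    by (simp add: algebra_simps)
  also have "\<dots> \<le> (t ^ 3 - 1) * n ^ (t - 2) + n ^ (t - 2)"
    using ct c2 by (intro add_mono mult_left_mono) auto
  also have "\<dots> = t ^ 3 * n ^ (t - 2)"
    using t5 by (cases "t ^ 3") (auto simp: algebra_simps)
  finally have "real (((t ^ 3 - 1) * (n choose (t - 2)) + (n choose 2)) * fact (t - 2)) \<le> real (t ^ 3 * n ^ (t - 2))"
    by (simp only: of_nat_le_iff)
  then have "8 * (real (t ^ 3 - 1) * real (n choose (t - 2)) + real (n choose 2)) * fact (t - 2)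
      \<le> 8 * real t ^ 3 * real n ^ (t - 2)"
    by (simp only: of_nat_mult of_nat_add of_nat_fact of_nat_power mult.assoc)
  also have "\<dots> \<le> fact (t - 2) * 2 ^ (t choose 2)"
    using t5 n by (intro spencer_bound_power) auto
  finally have "8 * (real (t ^ 3 - 1) * real (n choose (t - 2)) + real (n choose 2)) \<le> 2 ^ (t choose 2)"
    by (simp add: mult.commute[of _ "fact (t - 2)"])
  then obtain X where X: "\<And>T. T \<in> nsets {..<n} t \<Longrightarrow> \<not> mono_pairs X T"
      "\<And>e. e \<in> nsets {..<n} 2 \<Longrightarrow> \<exists>S\<in>nsets {..<n} k. e \<subseteq> S \<and> mono_pairs X S"
    using colouring_exists[OF _ _ k room s1 s2 M, of "{..<n}"] by auto
  have "n < cover_ramsey k (complete_graph t) (complete_graph t)"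
    by (rule cover_ramsey_complete_graph_gt[OF _ _ k X]) auto
  then show ?thesis using n by linarith
qed

theorem theorem2:
  fixes k :: nat
  assumes "k \<ge> 2"
  shows "\<exists>\<epsilon> :: nat \<Rightarrow> real. \<epsilon> \<longlonglongrightarrow> 0 \<and>
    (\<forall>\<^sub>F t in sequentially.
       real (cover_ramsey k (complete_graph t) (complete_graph t))
         > (1 + \<epsilon> t) * (sqrt 2 / exp 1) * real t * 2 powr (real t / 2))"
proof (intro exI conjI)
  \<comment> \<open>With this choice the right-hand side is exactly \<open>spencer_bound t\<close>
    for positive \<open>t\<close>.\<close>
  let ?\<epsilon> = "\<lambda>t. spencer_bound t / (sqrt 2 / exp 1 * real t * 2 powr (real t / 2)) - 1"
  show "?\<epsilon> \<longlonglongrightarrow> 0" by (rule spencer_bound_asymp)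
  show "\<forall>\<^sub>F t in sequentially. real (cover_ramsey k (complete_graph t) (complete_graph t))
         > (1 + ?\<epsilon> t) * (sqrt 2 / exp 1) * real t * 2 powr (real t / 2)"
    using spencer_bound_ge eventually_ge_at_top[of "2 ^ ((k choose 2) - 1) * ((k choose 2) + k) + 5"]
  proof eventually_elim
    case (elim t)
    have "(1 + ?\<epsilon> t) * (sqrt 2 / exp 1) * real t * 2 powr (real t / 2) = spencer_bound t"
      using elim(2) by simp
    then show ?case
      using cover_ramsey_gt_spencer_bound[OF assms elim(2,1)] by simp
  qed
qed

end
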